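(* For the class $\mathcal{S}_c^*$ of starlike functions associated with a cardioid, the following hold: (i) $R_{\mathcal{S}_{c}^{*}}(\mathcal{G}_1)= (\sqrt{85}-9)/2\approx 0.1097$; (ii) $R_{\mathcal{S}_{c}^{*}}(\mathcal{G}_2)\geq (\sqrt{265}-15)/10\approx 0.1279$; (iii) $R_{\mathcal{S}_{c}^{*}}(\mathcal{G}_3)= \sqrt{10}-3\approx 0.1623$.
   Context: $\mathbb{D}$ is the open unit disc in $\mathbb{C}$. $\mathcal{A}$ is the class of analytic functions $f$ on $\mathbb{D}$ with $f(0)=0$, $f'(0)=1$. $\mathcal{P}$ is the class of analytic functions $p$ on $\mathbb{D}$ with $p(0)=1$ and $\operatorname{Re}p(z)>0$ for all $z\in\mathbb{D}$; $\mathcal{P}(1/2)=\{p\in\mathcal{P}:\operatorname{Re}p(z)>1/2 \text{ for all } z\in\mathbb{D}\}$. Quotients below are understood with removable singularities filled in (in particular at $0$). Define $\mathcal{G}_1=\{f\in\mathcal{A}: f/g\in\mathcal{P}\text{ and } g/(zp)\in\mathcal{P}\text{ for some } g\in\mathcal{A},\ p\in\mathcal{P}\}$, $\mathcal{G}_2=\{f\in\mathcal{A}: f/g\in\mathcal{P}\text{ and } g/(zp)\in\mathcal{P}(1/2)\text{ for some } g\in\mathcal{A},\ p\in\mathcal{P}\}$, $\mathcal{G}_3=\{f\in\mathcal{A}: f/(zp)\in\mathcal{P}\text{ for some } p\in\mathcal{P}\}$. For subclasses $\mathcal{F},\mathcal{G}$ of $\mathcal{A}$, the $\mathcal{G}$-radius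 $R_{\mathcal{G}}(\mathcal{F})$ of $\mathcal{F}$ is the largest number $R\in(0,1)$ such that, for every $f\in\mathcal{F}$ and every $0<r<R$, the function $z\mapsto r^{-1}f(rz)$ belongs to $\mathcal{G}$. For analytic $f,g$ on $\mathbb{D}$, $f\prec g$ ($f$ is subordinate to $g$) means $f=g\circ w$ for some analytic $w:\mathbb{D}\to\mathbb{D}$ with $w(0)=0$. For an analytic univalent $\varphi$ on $\mathbb{D}$ with $\varphi(0)=1$, $\mathcal{S}^*(\varphi)=\{f\in\mathcal{A}: zf'(z)/f(z)\prec\varphi(z)\}$. $\mathcal{S}_c^*=\mathcal{S}^*\left(1+\tfrac43 z+\tfrac23 z^2\right)$. *)

theory Defs
  imports "HOL-Complex_Analysis.Complex_Analysis"
begin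

text \<open>
  Functions on the open unit disc are represented by total functions \<^typ>\<open>complex \<Rightarrow> complex\<close>.
  All notions below depend only on the values inside the disc.
\<close>

abbreviation unit_disc :: "complex set" where
  "unit_disc \<equiv> ball 0 1"

definition class_A :: "(complex \<Rightarrow> complex) set" where
  "class_A = {f. f holomorphic_on unit_disc \<and> f 0 = 0 \<and> deriv f 0 = 1}"

definition class_P :: "(complex \<Rightarrow> complex) set" where
  "class_P = {p. p holomorphic_on unit_disc \<and> p 0 = 1 \<and> (\<forall>z\<in>unit_disc. Re (p z) > 0)}"

definition class_P_half :: "(complex \<Rightarrow> complex) set" where
  "class_P_half = {p \<in> class_P. \<forall>z\<in>unit_disc. Re (p z) > 1 / 2}"

text \<open>
  The quotient of two functions with its removable singularities filled in.  At a pole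
  \<^const>\<open>remove_sings\<close> returns the value 0, so a quotient with a pole in the disc is not
  holomorphic there.
\<close>

definition quot :: "(complex \<Rightarrow> complex) \<Rightarrow> (complex \<Rightarrow> complex) \<Rightarrow> complex \<Rightarrow> complex" where
  "quot f g = remove_sings (\<lambda>z. f z / g z)"

definition class_G1 :: "(complex \<Rightarrow> complex) set" where
  "class_G1 = {f \<in> class_A. \<exists>g\<in>class_A. \<exists>p\<in>class_P.
     quot f g \<in> class_P \<and> quot g (\<lambda>z. z * p z) \<in> class_P}"

definition class_G2 :: "(complex \<Rightarrow> complex) set" where
  "class_G2 = {f \<in> class_A. \<exists>g\<in>class_A. \<exists>p\<in>class_P.
     quot f g \<in> class_P \<and> quot g (\<lambda>z. z * p z) \<in> class_P_half}"

definition class_G3 :: "(complex \<Rightarrow> complex) set" where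
  "class_G3 = {f \<in> class_A. \<exists>p\<in>class_P. quot f (\<lambda>z. z * p z) \<in> class_P}"

definition subordinate :: "(complex \<Rightarrow> complex) \<Rightarrow> (complex \<Rightarrow> complex) \<Rightarrow> bool" where
  "subordinate f g \<longleftrightarrow>
     f holomorphic_on unit_disc \<and> g holomorphic_on unit_disc \<and>
     (\<exists>w. w holomorphic_on unit_disc \<and> w ` unit_disc \<subseteq> unit_disc \<and> w 0 = 0 \<and>
          (\<forall>z\<in>unit_disc. f z = g (w z)))"

text \<open>
  The class \<open>S\<^sup>*(\<phi>)\<close>, meant for \<open>\<phi>\<close> holomorphic and injective on the disc with \<open>\<phi> 0 = 1\<close>.
\<close>

definition starlike_class :: "(complex \<Rightarrow> complex) \<Rightarrow> (complex \<Rightarrow> complex) set" where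
  "starlike_class \<phi> = {f \<in> class_A. subordinate (quot (\<lambda>z. z * deriv f z) f) \<phi>}"

definition cardioid :: "complex \<Rightarrow> complex" where
  "cardioid z = 1 + 4 / 3 * z + 2 / 3 * z ^ 2"

lemma cardioid_0: "cardioid 0 = 1"
  by (simp add: cardioid_def)

lemma cardioid_holomorphic: "cardioid holomorphic_on unit_disc"
  unfolding cardioid_def by (intro holomorphic_intros)

lemma cardioid_univalent: "inj_on cardioid unit_disc"
proof (rule inj_onI)
  fix z w :: complex
  assume z: "z \<in> unit_disc" and w: "w \<in> unit_disc" and eq: "cardioid z = cardioid w"
  have "cardioid z - cardioid w = 2 / 3 * ((z - w) * (z + w + 2))"
    by (simp add: cardioid_def power2_eq_square field_simps)
  then have "(z - w) * (z + w + 2) = 0"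
    using eq by simp
  moreover have "z + w + 2 \<noteq> 0"
  proof
    assume "z + w + 2 = 0"
    then have "norm (z + w) = 2"
      by (metis add_eq_0_iff norm_minus_cancel norm_numeral)
    then show False
      using norm_triangle_ineq[of z w] z w by simp
  qed
  ultimately show "z = w"
    by simp
qed

definition class_Sc :: "(complex \<Rightarrow> complex) set" where
  "class_Sc = starlike_class cardioid"

definition admissible_radius ::
    "(complex \<Rightarrow> complex) set \<Rightarrow> (complex \<Rightarrow> complex) set \<Rightarrow> real \<Rightarrow> bool" where
  "admissible_radius G F R \<longleftrightarrow> 0 < R \<and> R < 1 \<and>
     (\<forall>f\<in>F. \<forall>r. 0 < r \<and> r < R \<longrightarrow> (\<lambda>z. f (of_real r * z) / of_real r) \<in> G)"

text \<open>
  \<open>is_radius G F R\<close> says that the \<open>G\<close>-radius of \<open>F\<close> exists and equals \<open>R\<close>.  A relation is used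
  because a largest admissible number need not exist for arbitrary \<open>G\<close> and \<open>F\<close>.
\<close>

definition is_radius ::
    "(complex \<Rightarrow> complex) set \<Rightarrow> (complex \<Rightarrow> complex) set \<Rightarrow> real \<Rightarrow> bool" where
  "is_radius G F R \<longleftrightarrow>
     admissible_radius G F R \<and> (\<forall>R'. admissible_radius G F R' \<longrightarrow> R' \<le> R)"

end

theory Submission
  imports Defs
begin

text \<open>
  A function in one of the three classes is \<open>f z = z * h z\<close> with \<open>h\<close> a product of two or three
  functions of positive real part, so \<open>z f'(z) / f(z) = 1 + z h'(z) / h(z)\<close>, and the logarithmic
  derivative of \<open>h\<close> is the sum of those of its factors.  On \<open>|z| = r\<close>, Schwarz-Pick for the
  right half-plane bounds the contribution of a factor in \<open>P\<close> by \<open>2r / (1 - r\<^sup>2)\<close>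
  (\<open>class_P_log_deriv_bound\<close>), and that of a factor in \<open>P(1/2)\<close> by \<open>r / (1 - r)\<close>
  (\<open>class_P_half_log_deriv_bound\<close>).

  The cardioid function is \<open>1/3 + 2/3 (z + 1)\<^sup>2\<close>.  Its image contains the disc of radius \<open>2/3\<close>
  about \<open>1\<close> (\<open>subordinate_cardioidI\<close>) and misses the real ray up to \<open>1/3\<close>
  (\<open>cardioid_omits_left_ray\<close>).  Hence \<open>R\<close> is admissible as soon as the bounds for the factors add
  up to less than \<open>2/3\<close> on \<open>|z| < R\<close>.  The critical equations are \<open>6r / (1 - r\<^sup>2) = 2/3\<close> for the
  first class, \<open>4r / (1 - r\<^sup>2) + r / (1 - r) = 2/3\<close> for the second and \<open>4r / (1 - r\<^sup>2) = 2/3\<close> for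
  the third; their positive roots are the three stated numbers.

  The disc about \<open>1\<close> and the omitted ray meet at \<open>1/3\<close>.  The function
  \<open>z ((1 - z) / (1 + z))\<^sup>n\<close> attains equality in the bound for \<open>P\<close> in each of its \<open>n\<close> factors, and at
  real points \<open>s > 0\<close> the value \<open>1 - 2ns / (1 - s\<^sup>2)\<close> runs along the real axis to the left.  It
  reaches \<open>1/3\<close> exactly at the critical radius with \<open>n = 3\<close> for the first class and \<open>n = 2\<close> for
  the third, which makes these two radii sharp (\<open>admissible_radius_extremal_le\<close>).  The function
  with \<open>n = 2\<close> also lies in the second class.  It keeps the admissible numbers for that class
  away from \<open>1\<close>, so that their supremum is a radius (\<open>radius_exists\<close>).
\<close>

section \<open>Logarithmic derivatives of functions with positive real part\<close>

lemma norm_diff_less_norm_add_cnj: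
  fixes u b :: complex
  assumes "Re u > 0" "Re b > 0"
  shows "norm (u - b) < norm (u + cnj b)"
proof -
  have "(norm (u + cnj b))\<^sup>2 - (norm (u - b))\<^sup>2 = 4 * (Re u * Re b)"
    by (simp add: cmod_power2) (simp add: power2_eq_square algebra_simps)
  also have "\<dots> > 0"
    using assms by simp
  finally show ?thesis
    by (simp add: power2_less_imp_less)
qed

text \<open>
  The map \<open>u \<mapsto> (u - b) / (u + cnj b)\<close> takes the right half-plane to the disc and \<open>b\<close> to \<open>0\<close>.
  Composing \<open>p\<close> with it for \<open>b = p a\<close>, and on the right with the disc automorphism that takes \<open>0\<close>
  to \<open>a\<close>, gives a self-map of the disc fixing \<open>0\<close>, to which the Schwarz lemma applies.
\<close>

lemma Schwarz_Pick_right_half_plane: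
  assumes hol: "p holomorphic_on unit_disc"
    and pos: "\<And>z. z \<in> unit_disc \<Longrightarrow> Re (p z) > 0"
    and a: "a \<in> unit_disc"
  shows "norm (deriv p a) \<le> 2 * Re (p a) / (1 - (norm a)\<^sup>2)"
proof -
  define T where "T = Moebius_function 0 (-a)"
  define H where "H = (\<lambda>z. (p (T z) - p a) / (p (T z) + cnj (p a)))"
  have a1: "norm a < 1"
    using a by simp
  have T0: "T 0 = a"
    by (simp add: T_def Moebius_function_simple)
  have T_disc: "T z \<in> unit_disc" if "z \<in> unit_disc" for z
    using Moebius_function_norm_lt_1[of "-a" z 0] a1 that by (simp add: T_def)
  have T_hol: "T holomorphic_on unit_disc"
    unfolding T_def using a1 by (intro Moebius_function_holomorphic) simp
  have pT_hol: "(\<lambda>z. p (T z)) holomorphic_on unit_disc"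
    using holomorphic_on_compose_gen[OF T_hol hol] T_disc by (simp add: o_def image_subset_iff)
  have denom: "p (T z) + cnj (p a) \<noteq> 0" if "z \<in> unit_disc" for z
  proof -
    have "Re (p (T z) + cnj (p a)) > 0"
      using pos[OF T_disc[OF that]] pos[OF a] by simp
    then show ?thesis
      by force
  qed
  have H_hol: "H holomorphic_on ball 0 1"
    unfolding H_def using denom by (intro holomorphic_intros pT_hol) auto
  have H_less: "norm (H z) < 1" if "norm z < 1" for z
  proof -
    have z: "z \<in> unit_disc"
      using that by simp
    show ?thesis
      using norm_diff_less_norm_add_cnj[OF pos[OF T_disc[OF z]] pos[OF a]] denom[OF z]
      by (simp add: H_def norm_divide)
  qed
  have bound: "norm (deriv H 0) \<le> 1"
    using Schwarz_Lemma(2)[OF H_hol _ H_less, of 0] by (simp add: H_def T0)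
  have T': "(T has_field_derivative (1 - a * cnj a)) (at 0)"
    unfolding T_def Moebius_function_simple[abs_def]
    by (auto intro!: derivative_eq_intros simp: algebra_simps)
  have p': "(p has_field_derivative deriv p a) (at (T 0))"
    unfolding T0 using hol a holomorphic_derivI by blast
  have pT': "((\<lambda>z. p (T z)) has_field_derivative deriv p a * (1 - a * cnj a)) (at 0)"
    using DERIV_chain2[OF p' T'] .
  have "(H has_field_derivative deriv p a * (1 - a * cnj a) / (p a + cnj (p a))) (at 0)"
    using DERIV_divide[OF DERIV_diff[OF pT' DERIV_const[of "p a"]] DERIV_add[OF pT' DERIV_const] denom[of 0]]
      denom[of 0] by (simp add: H_def T0)
  then have "deriv H 0 = deriv p a * (1 - a * cnj a) / (p a + cnj (p a))"
    by (rule DERIV_imp_deriv)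
  also have "1 - a * cnj a = of_real (1 - (norm a)\<^sup>2)"
    by (simp only: complex_norm_square of_real_diff of_real_1)
  also have "p a + cnj (p a) = of_real (2 * Re (p a))"
    by (simp add: complex_add_cnj)
  finally have "norm (deriv H 0) = norm (deriv p a) * \<bar>1 - (norm a)\<^sup>2\<bar> / \<bar>2 * Re (p a)\<bar>"
    by (simp only: norm_mult norm_divide norm_of_real)
  moreover have "1 - (norm a)\<^sup>2 > 0"
    using a1 by (simp add: abs_square_less_1)
  ultimately have "norm (deriv p a) * (1 - (norm a)\<^sup>2) = norm (deriv H 0) * (2 * Re (p a))"
    using pos[OF a] by simp
  also have "\<dots> \<le> 1 * (2 * Re (p a))"
    using bound pos[OF a] by (intro mult_right_mono) auto
  finally show ?thesis
    using \<open>1 - (norm a)\<^sup>2 > 0\<close> by (simp add: pos_le_divide_eq)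
qed

lemma class_P_nonzero:
  assumes "p \<in> class_P" "z \<in> unit_disc"
  shows "p z \<noteq> 0"
  using assms by (force simp: class_P_def)

lemma class_P_log_deriv_bound:
  assumes p: "p \<in> class_P" and z: "z \<in> unit_disc"
  shows "norm (z * deriv p z / p z) \<le> 2 * norm z / (1 - (norm z)\<^sup>2)"
proof -
  have pos: "1 - (norm z)\<^sup>2 > 0"
    using z by (simp add: abs_square_less_1)
  have nz: "norm (p z) > 0"
    using class_P_nonzero[OF p z] by simp
  have "norm (deriv p z) \<le> 2 * Re (p z) / (1 - (norm z)\<^sup>2)"
    using p z by (intro Schwarz_Pick_right_half_plane) (auto simp: class_P_def)
  also have "\<dots> \<le> 2 * norm (p z) / (1 - (norm z)\<^sup>2)"
    using pos complex_Re_le_cmod[of "p z"] by (intro divide_right_mono) auto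
  finally have "norm (deriv p z) / norm (p z) \<le> 2 / (1 - (norm z)\<^sup>2)"
    using nz pos by (simp add: field_simps)
  then have "norm z * (norm (deriv p z) / norm (p z)) \<le> norm z * (2 / (1 - (norm z)\<^sup>2))"
    by (intro mult_left_mono) auto
  then show ?thesis
    by (simp add: norm_mult norm_divide mult.commute)
qed

text \<open>
  Inversion maps the half-plane \<open>Re u > 1/2\<close> onto the unit disc about \<open>1\<close>, so \<open>1 - 1 / p\<close> is a
  self-map of the disc fixing \<open>0\<close>, and the Schwarz lemma bounds \<open>1 / p\<close> away from \<open>0\<close>.
\<close>

lemma class_P_half_norm_bound:
  assumes p: "p \<in> class_P_half" and z: "z \<in> unit_disc"
  shows "(1 - norm z) * norm (p z) \<le> 1"
proof -
  have p': "p \<in> class_P" and half: "\<And>w. w \<in> unit_disc \<Longrightarrow> Re (p w) > 1 / 2"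
    using p by (auto simp: class_P_half_def)
  have hol: "(\<lambda>w. 1 - 1 / p w) holomorphic_on ball 0 1"
    using p' class_P_nonzero[OF p'] by (intro holomorphic_intros) (auto simp: class_P_def)
  have less: "norm (1 - 1 / p w) < 1" if "norm w < 1" for w
  proof -
    have w: "w \<in> unit_disc"
      using that by simp
    have "norm (p w - 1) < norm (p w)"
    proof (rule power2_less_imp_less)
      show "(norm (p w - 1))\<^sup>2 < (norm (p w))\<^sup>2"
        using half[OF w] by (simp add: cmod_power2) (simp add: power2_eq_square algebra_simps)
    qed simp
    moreover have "1 - 1 / p w = (p w - 1) / p w"
      using class_P_nonzero[OF p' w] by (simp add: field_simps)
    ultimately show ?thesis
      using class_P_nonzero[OF p' w] by (simp add: norm_divide)
  qed
  have "norm (1 - 1 / p z) \<le> norm z"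
    using Schwarz_Lemma(1)[OF hol _ less, of z] p' z by (simp add: class_P_def)
  then have "1 - norm z \<le> norm (1 / p z)"
    using norm_triangle_ineq2[of 1 "1 - 1 / p z"] by simp
  then show ?thesis
    using class_P_nonzero[OF p' z] by (simp add: norm_divide field_simps)
qed

text \<open>
  Schwarz-Pick for \<open>2 p - 1\<close> bounds \<open>|p'| (1 - r\<^sup>2)\<close> by \<open>2 Re p - 1\<close>, hence by \<open>2 |p| - 1\<close>, and
  \<open>1 \<ge> (1 - r) |p|\<close> turns this into a multiple of \<open>|p|\<close>.  A factor \<open>1 + r\<close> cancels.
\<close>

lemma class_P_half_log_deriv_bound:
  assumes p: "p \<in> class_P_half" and z: "z \<in> unit_disc"
  shows "norm (z * deriv p z / p z) \<le> norm z / (1 - norm z)"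
proof -
  have p': "p \<in> class_P" and half: "\<And>w. w \<in> unit_disc \<Longrightarrow> Re (p w) > 1 / 2"
    using p by (auto simp: class_P_half_def)
  have hol: "p holomorphic_on unit_disc"
    using p' by (simp add: class_P_def)
  have z1: "norm z < 1"
    using z by simp
  have fac: "1 - (norm z)\<^sup>2 = (1 - norm z) * (1 + norm z)"
    by (simp add: power2_eq_square algebra_simps)
  have pos: "1 - (norm z)\<^sup>2 > 0"
    using z by (simp add: abs_square_less_1)
  have nz: "norm (p z) > 0"
    using class_P_nonzero[OF p' z] by simp
  have "norm (deriv (\<lambda>w. 2 * p w - 1) z) \<le> 2 * Re (2 * p z - 1) / (1 - (norm z)\<^sup>2)"
  proof (rule Schwarz_Pick_right_half_plane[OF _ _ z])
    show "(\<lambda>w. 2 * p w - 1) holomorphic_on unit_disc"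
      by (intro holomorphic_intros hol)
  qed (use half in fastforce)
  moreover have "deriv (\<lambda>w. 2 * p w - 1) z = 2 * deriv p z"
    using holomorphic_derivI[OF hol open_ball z]
    by (intro DERIV_imp_deriv) (auto intro!: derivative_eq_intros)
  ultimately have "norm (deriv p z) * (1 - (norm z)\<^sup>2) \<le> 2 * Re (p z) - 1"
    using pos by (simp add: norm_mult field_simps)
  also have "\<dots> \<le> 2 * norm (p z) - (1 - norm z) * norm (p z)"
    using complex_Re_le_cmod[of "p z"] class_P_half_norm_bound[OF p z] by linarith
  also have "\<dots> = (1 + norm z) * norm (p z)"
    by (simp add: algebra_simps)
  finally have "(1 + norm z) * (norm (deriv p z) * (1 - norm z)) \<le> (1 + norm z) * norm (p z)"
    by (simp add: fac algebra_simps)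
  moreover have "1 + norm z > 0"
    by (simp add: add_pos_nonneg)
  ultimately have "norm (deriv p z) * (1 - norm z) \<le> norm (p z)"
    by (simp only: mult_le_cancel_left_pos)
  then have "norm (deriv p z) / norm (p z) \<le> 1 / (1 - norm z)"
    using nz z1 by (simp add: field_simps)
  then have "norm z * (norm (deriv p z) / norm (p z)) \<le> norm z * (1 / (1 - norm z))"
    by (intro mult_left_mono) auto
  then show ?thesis
    by (simp add: norm_mult norm_divide)
qed

lemma log_deriv_mult:
  assumes "f holomorphic_on unit_disc" "g holomorphic_on unit_disc" "z \<in> unit_disc"
    and "f z \<noteq> 0" "g z \<noteq> 0"
  shows "z * deriv (\<lambda>w. f w * g w) z / (f z * g z)
       = z * deriv f z / f z + z * deriv g z / g z"
proof -
  have "deriv (\<lambda>w. f w * g w) z = f z * deriv g z + deriv f z * g z"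
    using assms by (intro deriv_mult) (auto intro!: holomorphic_on_imp_differentiable_at)
  then show ?thesis
    using assms by (simp add: field_simps)
qed

section \<open>Quotients with removable singularities filled in\<close>

text \<open>
  The filled-in value is a limit, so an identity on the punctured disc determines it everywhere,
  also at \<open>0\<close>, where the quotients in question have the form \<open>0 / 0\<close>.
\<close>

lemma quot_eqI:
  assumes "z \<in> unit_disc" "isCont q z"
    and "\<And>w. w \<in> unit_disc \<Longrightarrow> w \<noteq> 0 \<Longrightarrow> f w / g w = q w"
  shows "quot f g z = q z"
  unfolding quot_def
proof (rule remove_sings_eqI)
  have "\<forall>\<^sub>F w in at z. w \<in> unit_disc - {0, z}"
  proof -
    have "\<forall>\<^sub>F w in nhds z. w \<in> unit_disc"
      using assms(1) by (intro eventually_nhds_in_open) auto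
    then have "\<forall>\<^sub>F w in at z. w \<in> unit_disc"
      by (simp add: eventually_at_filter eventually_mono)
    moreover have "\<forall>\<^sub>F w in at z. w \<noteq> 0"
      by (rule eventually_neq_at_within)
    moreover have "\<forall>\<^sub>F w in at z. w \<noteq> z"
      by (rule eventually_neq_at_within)
    ultimately show ?thesis
      by eventually_elim auto
  qed
  then have "\<forall>\<^sub>F w in at z. f w / g w = q w"
    by eventually_elim (use assms(3) in auto)
  then show "(\<lambda>w. f w / g w) \<midarrow>z\<rightarrow> q z"
    using assms(2) by (simp add: isCont_def tendsto_cong)
qed

text \<open>
  Both sides are holomorphic and they agree on the nonempty open set where \<open>g\<close> does not vanish.
  The identity theorem covers the zeros of \<open>g\<close>, so the defining quotients of the classes
  may be multiplied out on the whole disc.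
\<close>

lemma quot_mult_cancel:
  assumes f: "f holomorphic_on unit_disc" and g: "g holomorphic_on unit_disc"
    and q: "quot f g holomorphic_on unit_disc"
    and g': "deriv g 0 \<noteq> 0" and z: "z \<in> unit_disc"
  shows "f z = quot f g z * g z"
proof (rule analytic_continuation_open[where s = "{w \<in> unit_disc. g w \<noteq> 0}" and s' = unit_disc
        and f = f and g = "\<lambda>z. quot f g z * g z"])
  have "open (unit_disc \<inter> g -` (- {0}))"
    using holomorphic_on_imp_continuous_on[OF g] by (intro continuous_open_preimage) auto
  also have "unit_disc \<inter> g -` (- {0}) = {w \<in> unit_disc. g w \<noteq> 0}"
    by auto
  finally show "open {w \<in> unit_disc. g w \<noteq> 0}" .
  show "{w \<in> unit_disc. g w \<noteq> 0} \<noteq> {}"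
  proof
    assume "{w \<in> unit_disc. g w \<noteq> 0} = {}"
    then have "\<forall>\<^sub>F w in nhds 0. g w = 0"
      by (intro eventually_nhds_in_open[of unit_disc 0, THEN eventually_mono]) auto
    then have "deriv g 0 = deriv (\<lambda>_. 0) 0"
      by (intro deriv_cong_ev) auto
    with g' show False
      by simp
  qed
  show "f w = quot f g w * g w" if "w \<in> {w \<in> unit_disc. g w \<noteq> 0}" for w
  proof -
    have "f analytic_on {w}" "g analytic_on {w}"
      using f g that by (auto intro: holomorphic_on_imp_analytic_at)
    then have "(\<lambda>z. f z / g z) analytic_on {w}"
      using that by (intro analytic_intros) auto
    then show ?thesis
      using that by (simp add: quot_def)
  qed
qed (use f q g z in \<open>auto intro!: holomorphic_intros\<close>)

lemma deriv_times_id_at_0: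
  fixes h :: "complex \<Rightarrow> complex"
  assumes "h holomorphic_on unit_disc"
  shows "deriv (\<lambda>z. z * h z) 0 = h 0"
proof -
  have "(h has_field_derivative deriv h 0) (at 0)"
    using assms by (intro holomorphic_derivI[of _ unit_disc]) auto
  then show ?thesis
    by (intro DERIV_imp_deriv) (auto intro!: derivative_eq_intros)
qed

lemma class_A_timesI:
  assumes "h holomorphic_on unit_disc" "h 0 = 1"
  shows "(\<lambda>z. z * h z) \<in> class_A"
  using assms by (auto simp: class_A_def deriv_times_id_at_0 intro!: holomorphic_intros)

lemma quot_z_times_class_P:
  assumes "f \<in> class_A" "p \<in> class_P" "quot f (\<lambda>z. z * p z) holomorphic_on unit_disc"
    and "z \<in> unit_disc"
  shows "f z = z * (p z * quot f (\<lambda>z. z * p z) z)"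
proof -
  have p: "p holomorphic_on unit_disc" "p 0 = 1"
    using assms(2) by (auto simp: class_P_def)
  have "f z = quot f (\<lambda>z. z * p z) z * (z * p z)"
    using assms p by (intro quot_mult_cancel) (auto simp: class_A_def deriv_times_id_at_0 intro!: holomorphic_intros)
  then show ?thesis
    by (simp add: mult_ac)
qed

lemma class_G3_factorization:
  assumes "f \<in> class_G3"
  obtains p q where "p \<in> class_P" "q \<in> class_P" "\<And>z. z \<in> unit_disc \<Longrightarrow> f z = z * (p z * q z)"
proof -
  obtain p where p: "p \<in> class_P" and q: "quot f (\<lambda>z. z * p z) \<in> class_P" and f: "f \<in> class_A"
    using assms by (auto simp: class_G3_def)
  show ?thesis
    by (rule that[OF p q]) (use quot_z_times_class_P[OF f p] q in \<open>auto simp: class_P_def\<close>)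
qed

lemma two_step_factorization:
  assumes f: "f \<in> class_A" and g: "g \<in> class_A" and p: "p \<in> class_P"
    and q: "quot f g \<in> class_P" and s: "quot g (\<lambda>z. z * p z) \<in> class_P" and z: "z \<in> unit_disc"
  shows "f z = z * ((p z * quot f g z) * quot g (\<lambda>z. z * p z) z)"
proof -
  have "f z = quot f g z * g z"
    using f g q z by (intro quot_mult_cancel) (auto simp: class_A_def class_P_def)
  also have "g z = z * (p z * quot g (\<lambda>z. z * p z) z)"
    using g p s z by (intro quot_z_times_class_P) (auto simp: class_P_def)
  finally show ?thesis
    by (simp add: mult_ac)
qed

section \<open>Subordination to the cardioid function\<close>

text \<open>
  Since \<open>cardioid w = 1/3 + 2/3 (w + 1)\<^sup>2\<close>, the equation \<open>q = cardioid w\<close> is solved by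
  \<open>w = csqrt (1 + u) - 1\<close> with \<open>u = 3/2 (q - 1)\<close>.  As \<open>|u| < 1\<close>, the principal root is holomorphic,
  and \<open>w (csqrt (1 + u) + 1) = u\<close>, where the second factor has real part at least \<open>1\<close>, gives
  \<open>|w| \<le> |u| < 1\<close>.
\<close>

lemma subordinate_cardioidI:
  assumes hol: "q holomorphic_on unit_disc" and q0: "q 0 = 1"
    and bound: "\<And>z. z \<in> unit_disc \<Longrightarrow> norm (q z - 1) < 2 / 3"
  shows "subordinate q cardioid"
proof -
  define u where "u = (\<lambda>z. 3 / 2 * (q z - 1))"
  define w where "w = (\<lambda>z. csqrt (1 + u z) - 1)"
  have u1: "norm (u z) < 1" if "z \<in> unit_disc" for z
    using bound[OF that] unfolding u_def norm_mult by simp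
  have Re_pos: "Re (1 + u z) > 0" if "z \<in> unit_disc" for z
    using u1[OF that] abs_Re_le_cmod[of "u z"] by simp
  have u_hol: "u holomorphic_on unit_disc"
    unfolding u_def by (intro holomorphic_intros hol)
  have w_hol: "w holomorphic_on unit_disc"
    unfolding w_def using Re_pos by (intro holomorphic_intros u_hol) (force simp: complex_nonpos_Reals_iff)
  have w_less: "w z \<in> unit_disc" if "z \<in> unit_disc" for z
  proof -
    have "w z * (csqrt (1 + u z) + 1) = (csqrt (1 + u z))\<^sup>2 - 1"
      by (simp add: w_def power2_eq_square algebra_simps)
    then have prod: "w z * (csqrt (1 + u z) + 1) = u z"
      by simp
    have "1 \<le> Re (csqrt (1 + u z) + 1)"
      using Re_csqrt[of "1 + u z"] by (simp del: csqrt.simps)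
    then have "1 \<le> norm (csqrt (1 + u z) + 1)"
      using complex_Re_le_cmod order_trans by blast
    then have "norm (w z) * 1 \<le> norm (w z) * norm (csqrt (1 + u z) + 1)"
      by (intro mult_left_mono) auto
    also have "\<dots> = norm (u z)"
      using prod by (metis norm_mult)
    finally show ?thesis
      using u1[OF that] by simp
  qed
  have "cardioid (w z) = q z" for z
  proof -
    have "cardioid (w z) = 1 / 3 + 2 / 3 * (csqrt (1 + u z))\<^sup>2"
      unfolding cardioid_def w_def by (simp add: power2_eq_square field_simps del: csqrt.simps power2_csqrt)
    also have "\<dots> = q z"
      by (simp add: u_def field_simps)
    finally show ?thesis .
  qed
  then show ?thesis
    unfolding subordinate_def using hol cardioid_holomorphic w_hol w_less
    by (intro conjI exI[of _ w]) (auto simp: w_def u_def q0)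
qed

text \<open>
  A value \<open>x \<le> 1/3\<close> would make \<open>(w + 1)\<^sup>2\<close> real and nonpositive, so \<open>w + 1\<close> would be imaginary,
  which the positive real part of \<open>w + 1\<close> rules out.
\<close>

lemma cardioid_omits_left_ray:
  assumes "w \<in> unit_disc" "x \<le> 1 / 3"
  shows "cardioid w \<noteq> of_real x"
proof
  assume eq: "cardioid w = of_real x"
  have "(w + 1)\<^sup>2 = 3 / 2 * (cardioid w - 1 / 3)"
    by (simp add: cardioid_def power2_eq_square field_simps)
  also have "\<dots> = of_real (3 / 2 * (x - 1 / 3))"
    by (simp add: eq)
  finally have sq: "(w + 1)\<^sup>2 = of_real (3 / 2 * (x - 1 / 3))" .
  have Re: "Re w + 1 > 0"
    using assms(1) abs_Re_le_cmod[of w] by simp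
  have "Im ((w + 1)\<^sup>2) = 0"
    by (simp only: sq Im_complex_of_real)
  then have "Im w = 0"
    using Re by (simp add: power2_eq_square)
  then have "Re ((w + 1)\<^sup>2) = (Re w + 1)\<^sup>2"
    by (simp add: power2_eq_square)
  moreover have "Re ((w + 1)\<^sup>2) \<le> 0"
    using assms(2) by (simp only: sq Re_complex_of_real) simp
  ultimately show False
    using Re by simp
qed

lemma quot_dilation:
  assumes h: "h holomorphic_on unit_disc"
    and nz: "\<And>z. z \<in> unit_disc \<Longrightarrow> h z \<noteq> 0"
    and f: "\<And>z. z \<in> unit_disc \<Longrightarrow> f z = z * h z"
    and r: "0 < r" "r < 1" and z: "z \<in> unit_disc"
  defines "F \<equiv> \<lambda>z. f (of_real r * z) / of_real r"
  shows "quot (\<lambda>z. z * deriv F z) F z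
       = 1 + of_real r * z * deriv h (of_real r * z) / h (of_real r * z)"
proof -
  have rz: "of_real r * w \<in> unit_disc" if "w \<in> unit_disc" for w :: complex
  proof -
    have "r * norm w < 1"
      using r that by (metis less_eq_real_def mem_ball_0 mult.commute mult_1 mult_strict_mono norm_ge_zero zero_less_one)
    then show ?thesis
      using r by (simp add: norm_mult)
  qed
  have h': "(h has_field_derivative deriv h w) (at w)" if "w \<in> unit_disc" for w
    using h that by (intro holomorphic_derivI[of _ unit_disc]) auto
  have F: "F w = w * h (of_real r * w)" if "w \<in> unit_disc" for w
    using f[OF rz[OF that]] r by (simp add: F_def)
  have F': "deriv F w = h (of_real r * w) + of_real r * w * deriv h (of_real r * w)"
    if "w \<in> unit_disc" for w
  proof -
    have "((\<lambda>w. h (of_real r * w)) has_field_derivative deriv h (of_real r * w) * of_real r) (at w)"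
      by (rule DERIV_chain2[where f = h and g = "\<lambda>w. of_real r * w", OF h'[OF rz[OF that]]]) (auto intro!: derivative_eq_intros)
    then have "((\<lambda>w. w * h (of_real r * w)) has_field_derivative
        h (of_real r * w) + of_real r * w * deriv h (of_real r * w)) (at w)"
      by (auto intro!: derivative_eq_intros)
    then have "(F has_field_derivative
        h (of_real r * w) + of_real r * w * deriv h (of_real r * w)) (at w)"
      using that F by (elim has_field_derivative_transform_within_open[where S = unit_disc]) auto
    then show ?thesis
      by (rule DERIV_imp_deriv)
  qed
  show ?thesis
  proof (rule quot_eqI[OF z])
    have "(\<lambda>w. w * deriv h w / h w) holomorphic_on unit_disc"
      using nz by (intro holomorphic_intros h) auto
    then have "isCont (\<lambda>w. w * deriv h w / h w) (of_real r * z)"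
      using rz[OF z] by (meson continuous_on_eq_continuous_at holomorphic_on_imp_continuous_on open_ball)
    then have "isCont (\<lambda>w. of_real r * w * deriv h (of_real r * w) / h (of_real r * w)) z"
      by (intro isCont_o2[where g = "\<lambda>w. w * deriv h w / h w" and f = "\<lambda>w. of_real r * w"]) auto
    then show "isCont (\<lambda>w. 1 + of_real r * w * deriv h (of_real r * w) / h (of_real r * w)) z"
      by (rule continuous_add[OF continuous_const])
  next
    fix w :: complex
    assume w: "w \<in> unit_disc" "w \<noteq> 0"
    show "w * deriv F w / F w = 1 + of_real r * w * deriv h (of_real r * w) / h (of_real r * w)"
      using nz[OF rz[OF w(1)]] w by (simp add: F F' field_simps)
  qed
qed

lemma dilation_in_class_Sc:
  assumes h: "h holomorphic_on unit_disc" "h 0 = 1"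
    and nz: "\<And>z. z \<in> unit_disc \<Longrightarrow> h z \<noteq> 0"
    and f: "\<And>z. z \<in> unit_disc \<Longrightarrow> f z = z * h z"
    and r: "0 < r" "r < 1"
    and bound: "\<And>z. norm z < r \<Longrightarrow> norm (z * deriv h z / h z) < 2 / 3"
  shows "(\<lambda>z. f (of_real r * z) / of_real r) \<in> class_Sc"
proof -
  define F where "F = (\<lambda>z. f (of_real r * z) / of_real r)"
  define k where "k = (\<lambda>z. 1 + of_real r * z * deriv h (of_real r * z) / h (of_real r * z))"
  have rz: "norm (of_real r * w) < r" if "w \<in> unit_disc" for w :: complex
    using r that by (simp add: norm_mult)
  then have rz1: "of_real r * w \<in> unit_disc" if "w \<in> unit_disc" for w :: complex
    using that r by fastforce
  have hr: "(\<lambda>z. h (of_real r * z)) holomorphic_on unit_disc"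
    using holomorphic_on_compose_gen[OF _ h(1), of "\<lambda>z. of_real r * z" unit_disc] rz1
    by (simp add: o_def image_subset_iff holomorphic_on_mult holomorphic_on_const holomorphic_on_ident)
  have h'r: "(\<lambda>z. deriv h (of_real r * z)) holomorphic_on unit_disc"
    using holomorphic_on_compose_gen[OF _ holomorphic_deriv[OF h(1)], of "\<lambda>z. of_real r * z" unit_disc] rz1
    by (simp add: o_def image_subset_iff holomorphic_on_mult holomorphic_on_const holomorphic_on_ident)
  have F: "F z = z * h (of_real r * z)" if "z \<in> unit_disc" for z
    using f[OF rz1[OF that]] r by (simp add: F_def)
  have A: "F \<in> class_A"
  proof -
    have G: "(\<lambda>z. z * h (of_real r * z)) \<in> class_A"
      using hr h(2) by (intro class_A_timesI) auto
    have "\<forall>\<^sub>F z in nhds 0. F z = z * h (of_real r * z)"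
      using F by (intro eventually_nhds_in_open[of unit_disc 0, THEN eventually_mono]) auto
    then have "deriv F 0 = deriv (\<lambda>z. z * h (of_real r * z)) 0"
      by (intro deriv_cong_ev) auto
    moreover have "F holomorphic_on unit_disc \<longleftrightarrow> (\<lambda>z. z * h (of_real r * z)) holomorphic_on unit_disc"
      using F by (intro holomorphic_cong) auto
    ultimately show ?thesis
      using G F[of 0] by (simp add: class_A_def)
  qed
  have Q: "quot (\<lambda>z. z * deriv F z) F z = k z" if "z \<in> unit_disc" for z
    unfolding F_def k_def by (rule quot_dilation[OF h(1) nz f r that])
  have "k holomorphic_on unit_disc"
    unfolding k_def using nz rz1 by (intro holomorphic_intros hr h'r) auto
  then have "quot (\<lambda>z. z * deriv F z) F holomorphic_on unit_disc"
    using Q by (subst holomorphic_cong[OF refl Q])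
  moreover have "quot (\<lambda>z. z * deriv F z) F 0 = 1"
    using Q[of 0] by (simp add: k_def)
  moreover have "norm (quot (\<lambda>z. z * deriv F z) F z - 1) < 2 / 3" if "z \<in> unit_disc" for z
    using bound[OF rz[OF that]] Q[OF that] by (simp add: k_def)
  ultimately have "subordinate (quot (\<lambda>z. z * deriv F z) F) cardioid"
    by (rule subordinate_cardioidI)
  then show ?thesis
    using A by (simp add: class_Sc_def starlike_class_def F_def)
qed

lemma admissible_radius_class_ScI:
  assumes R: "0 < R" "R < 1"
    and "\<And>f. f \<in> \<F> \<Longrightarrow> \<exists>h. h holomorphic_on unit_disc \<and> h 0 = 1 \<and>
        (\<forall>z\<in>unit_disc. h z \<noteq> 0 \<and> f z = z * h z) \<and>
        (\<forall>z. norm z < R \<longrightarrow> norm (z * deriv h z / h z) < 2 / 3)"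
  shows "admissible_radius class_Sc \<F> R"
  unfolding admissible_radius_def
proof (intro conjI ballI allI impI R)
  fix f r
  assume f: "f \<in> \<F>" and r: "0 < r \<and> r < R"
  obtain h where "h holomorphic_on unit_disc" "h 0 = 1"
      "\<forall>z\<in>unit_disc. h z \<noteq> 0 \<and> f z = z * h z"
      "\<forall>z. norm z < R \<longrightarrow> norm (z * deriv h z / h z) < 2 / 3"
    using assms(3)[OF f] by blast
  then show "(\<lambda>z. f (of_real r * z) / of_real r) \<in> class_Sc"
    using r R by (intro dilation_in_class_Sc[of h]) auto
qed

text \<open>
  If some admissible number exceeded \<open>R\<close>, one could dilate by an \<open>r > R\<close> and evaluate at the real
  point \<open>s / r\<close> with \<open>R < s < r\<close>.  There the cardioid function would take the value
  \<open>1 + s h'(s) / h(s)\<close>, which lies on the ray that it omits.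
\<close>

lemma admissible_radius_class_Sc_le:
  assumes adm: "admissible_radius class_Sc \<F> R'" and f: "f \<in> \<F>"
    and h: "h holomorphic_on unit_disc"
    and nz: "\<And>z. z \<in> unit_disc \<Longrightarrow> h z \<noteq> 0"
    and fh: "\<And>z. z \<in> unit_disc \<Longrightarrow> f z = z * h z"
    and R: "0 < R"
    and bad: "\<And>s. R < s \<Longrightarrow> s < 1 \<Longrightarrow>
      \<exists>x\<le>1 / 3. 1 + of_real s * deriv h (of_real s) / h (of_real s) = of_real x"
  shows "R' \<le> R"
proof (rule ccontr)
  assume "\<not> R' \<le> R"
  then obtain r where r: "R < r" "r < R'"
    using dense by (metis not_le)
  obtain s where s: "R < s" "s < r"
    using dense r(1) by blast
  have r1: "0 < r" "r < 1"
    using adm r R by (auto simp: admissible_radius_def)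
  define F where "F = (\<lambda>z. f (of_real r * z) / of_real r)"
  define z :: complex where "z = of_real (s / r)"
  have z: "z \<in> unit_disc"
    using s R r1 by (simp add: z_def norm_divide)
  have "F \<in> class_Sc"
    using adm f r r1 by (auto simp: admissible_radius_def F_def)
  then obtain w where w: "w ` unit_disc \<subseteq> unit_disc"
      "\<forall>z\<in>unit_disc. quot (\<lambda>z. z * deriv F z) F z = cardioid (w z)"
    by (auto simp: class_Sc_def starlike_class_def subordinate_def)
  have "cardioid (w z) = quot (\<lambda>z. z * deriv F z) F z"
    using w z by simp
  also have "\<dots> = 1 + of_real r * z * deriv h (of_real r * z) / h (of_real r * z)"
    unfolding F_def by (rule quot_dilation[OF h nz fh r1 z])
  also have "of_real r * z = of_real s"
    using r1 by (simp add: z_def)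
  finally obtain x where "x \<le> 1 / 3" "cardioid (w z) = of_real x"
    using bad[of s] s r1 by auto
  moreover have "w z \<in> unit_disc"
    using w(1) z by blast
  ultimately show False
    using cardioid_omits_left_ray by blast
qed

section \<open>Extremal functions\<close>

text \<open>
  A conformal map of the disc onto the right half-plane, decreasing along the real axis; the bound
  on the logarithmic derivative in \<open>P\<close> is attained for it at real points.
\<close>

definition cayley :: "complex \<Rightarrow> complex" where
  "cayley z = (1 - z) / (1 + z)"

lemma one_plus_nonzero: "1 + z \<noteq> 0" and one_minus_nonzero: "1 - z \<noteq> 0" if "z \<in> unit_disc" for z :: complex
  using that by (auto simp: add_eq_0_iff)

lemma cayley_nonzero: "cayley z \<noteq> 0" if "z \<in> unit_disc"
  using one_plus_nonzero[OF that] one_minus_nonzero[OF that] by (simp add: cayley_def)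

lemma cayley_holomorphic: "cayley holomorphic_on unit_disc"
  unfolding cayley_def using one_plus_nonzero by (intro holomorphic_intros) auto

lemma cayley_in_class_P: "cayley \<in> class_P"
proof -
  have "Re (cayley z) > 0" if z: "z \<in> unit_disc" for z
  proof -
    have "Re (cayley z) = (1 - (norm z)\<^sup>2) / (norm (1 + z))\<^sup>2"
      unfolding cayley_def Re_divide cmod_power2 by (simp add: power2_eq_square algebra_simps)
    moreover have "1 - (norm z)\<^sup>2 > 0"
      using z by (simp add: abs_square_less_1)
    ultimately show ?thesis
      using one_plus_nonzero[OF z] by simp
  qed
  then show ?thesis
    using cayley_holomorphic by (simp add: class_P_def) (simp add: cayley_def)
qed

lemma cayley_power_log_deriv:
  assumes z: "z \<in> unit_disc"
  shows "deriv (\<lambda>z. cayley z ^ n) z / cayley z ^ n = - (2 * of_nat n / (1 - z\<^sup>2))"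
proof -
  have nz: "1 + z \<noteq> 0" "1 - z \<noteq> 0" "cayley z \<noteq> 0"
    using z one_plus_nonzero one_minus_nonzero cayley_nonzero by auto
  have c: "(cayley has_field_derivative - (2 / (1 - z\<^sup>2)) * cayley z) (at z)"
  proof -
    have "(1 - z\<^sup>2) = (1 - z) * (1 + z)"
      by (simp add: power2_eq_square algebra_simps)
    then have "- (2 / (1 - z\<^sup>2)) * cayley z = - 2 / ((1 + z) * (1 + z))"
      using nz unfolding cayley_def
      by (simp only: minus_divide_left times_divide_times_eq mult.assoc) (simp add: divide_simps)
    then show ?thesis
      unfolding cayley_def[abs_def] using nz
      by (auto intro!: derivative_eq_intros simp: field_simps)
  qed
  show ?thesis
  proof (cases n)
    case (Suc m)
    have "((\<lambda>z. cayley z ^ n) has_field_derivative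
        of_nat n * cayley z ^ m * (- (2 / (1 - z\<^sup>2)) * cayley z)) (at z)"
      using DERIV_power[OF c, of n] by (simp add: Suc mult_ac)
    then have "deriv (\<lambda>z. cayley z ^ n) z = of_nat n * cayley z ^ m * (- (2 / (1 - z\<^sup>2)) * cayley z)"
      by (rule DERIV_imp_deriv)
    then show ?thesis
      using nz by (simp add: Suc)
  qed simp
qed

lemma quot_eq_of_mult:
  assumes a: "a \<in> \<C>" and C: "\<C> \<in> {class_P, class_P_half}"
    and b: "\<And>z. z \<in> unit_disc \<Longrightarrow> z \<noteq> 0 \<Longrightarrow> b z \<noteq> 0"
    and c: "\<And>z. z \<in> unit_disc \<Longrightarrow> c z = a z * b z"
  shows "quot c b \<in> \<C>"
proof -
  have hol: "a holomorphic_on unit_disc"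
    using a C by (auto simp: class_P_def class_P_half_def)
  have eq: "quot c b z = a z" if "z \<in> unit_disc" for z
  proof (rule quot_eqI[OF that])
    show "isCont a z"
      using hol that by (meson continuous_on_eq_continuous_at holomorphic_on_imp_continuous_on open_ball)
  qed (use b c in auto)
  have "quot c b holomorphic_on unit_disc"
    using hol by (subst holomorphic_cong[OF refl eq])
  then show ?thesis
    using a C eq by (auto simp: class_P_def class_P_half_def)
qed

definition extremal :: "nat \<Rightarrow> complex \<Rightarrow> complex" where
  "extremal n z = z * cayley z ^ n"

lemma extremal_in_class_A: "extremal n \<in> class_A"
  unfolding extremal_def
  by (intro class_A_timesI holomorphic_intros cayley_holomorphic) (simp add: cayley_def)

lemma extremal_in_class_G1: "extremal 3 \<in> class_G1"
proof -
  have "quot (extremal 3) (extremal 2) \<in> class_P"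
    by (rule quot_eq_of_mult[OF cayley_in_class_P])
       (auto simp: extremal_def cayley_nonzero eval_nat_numeral)
  moreover have "quot (extremal 2) (\<lambda>z. z * cayley z) \<in> class_P"
    by (rule quot_eq_of_mult[OF cayley_in_class_P])
       (auto simp: extremal_def cayley_nonzero eval_nat_numeral)
  ultimately show ?thesis
    using extremal_in_class_A cayley_in_class_P by (auto simp: class_G1_def)
qed

lemma extremal_in_class_G2: "extremal 2 \<in> class_G2"
proof -
  have one: "(\<lambda>_. 1) \<in> class_P_half"
    by (auto simp: class_P_half_def class_P_def)
  have "quot (extremal 2) (extremal 1) \<in> class_P"
    by (rule quot_eq_of_mult[OF cayley_in_class_P])
       (auto simp: extremal_def cayley_nonzero eval_nat_numeral)
  moreover have "quot (extremal 1) (\<lambda>z. z * cayley z) \<in> class_P_half"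
    by (rule quot_eq_of_mult[OF one]) (auto simp: extremal_def cayley_nonzero)
  ultimately show ?thesis
    using extremal_in_class_A cayley_in_class_P by (auto simp: class_G2_def)
qed

lemma extremal_in_class_G3: "extremal 2 \<in> class_G3"
proof -
  have "quot (extremal 2) (\<lambda>z. z * cayley z) \<in> class_P"
    by (rule quot_eq_of_mult[OF cayley_in_class_P])
       (auto simp: extremal_def cayley_nonzero eval_nat_numeral)
  then show ?thesis
    using extremal_in_class_A cayley_in_class_P by (auto simp: class_G3_def)
qed

text \<open>
  The equation for \<open>R\<close> is \<open>1 - 2nR / (1 - R\<^sup>2) = 1/3\<close> cleared of denominators.  Beyond its root
  the function \<open>extremal n\<close> has values of \<open>z f'(z) / f(z)\<close> on the omitted ray.
\<close>

lemma admissible_radius_extremal_le: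
  assumes adm: "admissible_radius class_Sc \<F> R'" and f: "extremal n \<in> \<F>"
    and R: "0 < R" and root: "R\<^sup>2 + 3 * real n * R = 1"
  shows "R' \<le> R"
proof (rule admissible_radius_class_Sc_le[OF adm f, where h = "\<lambda>z. cayley z ^ n"])
  fix s :: real
  assume s: "R < s" "s < 1"
  have "R\<^sup>2 \<le> s\<^sup>2"
    using s R by (intro power_mono) auto
  moreover have "3 * real n * R \<le> 3 * real n * s"
    using s by (intro mult_left_mono) auto
  ultimately have "1 - s\<^sup>2 \<le> 3 * real n * s"
    using root by linarith
  moreover have pos: "1 - s\<^sup>2 > 0"
    using s R by (simp add: abs_square_less_1)
  ultimately have "1 - s * (2 * real n / (1 - s\<^sup>2)) \<le> 1 / 3"
    by (simp add: field_simps)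
  moreover have "1 + of_real s * deriv (\<lambda>z. cayley z ^ n) (of_real s) / cayley (of_real s) ^ n
      = (of_real (1 - s * (2 * real n / (1 - s\<^sup>2))) :: complex)"
    using cayley_power_log_deriv[of "of_real s" n] s R by (simp flip: times_divide_eq_right)
  ultimately show "\<exists>x\<le>1 / 3. 1 + of_real s * deriv (\<lambda>z. cayley z ^ n) (of_real s) /
      cayley (of_real s) ^ n = of_real x"
    by blast
qed (use R in \<open>auto simp: extremal_def cayley_nonzero intro!: holomorphic_intros cayley_holomorphic\<close>)

section \<open>The radii\<close>

text \<open>
  Used with the critical equation for \<open>R\<close> in polynomial form, to obtain the strict inequality
  inside the disc of radius \<open>R\<close>.
\<close>

lemma power2_add_mult_less:
  fixes t R b c :: real
  assumes "0 \<le> t" "t < R" "0 \<le> c" "R\<^sup>2 + c * R = b"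
  shows "t\<^sup>2 + c * t < b"
proof -
  have "t\<^sup>2 < R\<^sup>2"
    using assms by (intro power_strict_mono) auto
  moreover have "c * t \<le> c * R"
    using assms by (intro mult_left_mono) auto
  ultimately show ?thesis
    using assms(4) by linarith
qed

text \<open>
  The form common to the three classes: two factors from \<open>P\<close> contribute \<open>4r / (1 - r\<^sup>2)\<close>, and the
  factor \<open>k\<close> is from \<open>P\<close>, from \<open>P(1/2)\<close>, or constant.
\<close>

lemma product_log_deriv_witness:
  assumes p: "p \<in> class_P" and q: "q \<in> class_P" and k: "k \<in> class_P"
    and f: "\<And>z. z \<in> unit_disc \<Longrightarrow> f z = z * ((p z * q z) * k z)"
    and R: "R < 1"
    and bound: "\<And>z. norm z < R \<Longrightarrow>
      4 * norm z / (1 - (norm z)\<^sup>2) + norm (z * deriv k z / k z) < 2 / 3"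
  shows "\<exists>h. h holomorphic_on unit_disc \<and> h 0 = 1 \<and>
      (\<forall>z\<in>unit_disc. h z \<noteq> 0 \<and> f z = z * h z) \<and>
      (\<forall>z. norm z < R \<longrightarrow> norm (z * deriv h z / h z) < 2 / 3)"
proof (intro exI[of _ "\<lambda>z. (p z * q z) * k z"] conjI ballI allI impI)
  have hols: "p holomorphic_on unit_disc" "q holomorphic_on unit_disc" "k holomorphic_on unit_disc"
    using p q k by (auto simp: class_P_def)
  have nz: "p z \<noteq> 0" "q z \<noteq> 0" "k z \<noteq> 0" if "z \<in> unit_disc" for z
    using class_P_nonzero that p q k by auto
  show "(\<lambda>z. (p z * q z) * k z) holomorphic_on unit_disc"
    by (intro holomorphic_intros hols)
  show "(p 0 * q 0) * k 0 = 1"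
    using p q k by (simp add: class_P_def)
  show "(p z * q z) * k z \<noteq> 0" "f z = z * ((p z * q z) * k z)" if "z \<in> unit_disc" for z
    using nz[OF that] f[OF that] by auto
  show "norm (z * deriv (\<lambda>z. (p z * q z) * k z) z / ((p z * q z) * k z)) < 2 / 3"
    if "norm z < R" for z
  proof -
    have z: "z \<in> unit_disc"
      using that R by simp
    have "z * deriv (\<lambda>z. (p z * q z) * k z) z / ((p z * q z) * k z)
        = z * deriv p z / p z + z * deriv q z / q z + z * deriv k z / k z"
      using log_deriv_mult[of "\<lambda>z. p z * q z" k z] log_deriv_mult[of p q z] nz[OF z] hols z
      by (simp add: holomorphic_on_mult)
    also have "norm \<dots> \<le> norm (z * deriv p z / p z) + norm (z * deriv q z / q z)
        + norm (z * deriv k z / k z)"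
      by (intro norm_triangle_mono norm_triangle_ineq order_refl)
    also have "\<dots> \<le> 4 * norm z / (1 - (norm z)\<^sup>2) + norm (z * deriv k z / k z)"
      using class_P_log_deriv_bound[OF p z] class_P_log_deriv_bound[OF q z] by simp
    also have "\<dots> < 2 / 3"
      by (rule bound[OF that])
    finally show ?thesis .
  qed
qed

lemma admissible_radius_class_G1: "admissible_radius class_Sc class_G1 ((sqrt 85 - 9) / 2)"
  (is "admissible_radius _ _ ?R")
proof (rule admissible_radius_class_ScI)
  have s: "9 < sqrt 85" "sqrt 85 < 10"
    by (rule real_less_rsqrt, simp) (rule real_less_lsqrt; simp)
  have root: "?R\<^sup>2 + 9 * ?R = 1"
    by (simp add: power2_eq_square field_simps)
  show "0 < ?R" and R1: "?R < 1"
    using s by auto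
  fix f
  assume "f \<in> class_G1"
  then obtain g p where f: "f \<in> class_A" and g: "g \<in> class_A" and p: "p \<in> class_P"
      and q: "quot f g \<in> class_P" and k: "quot g (\<lambda>z. z * p z) \<in> class_P"
    by (auto simp: class_G1_def)
  show "\<exists>h. h holomorphic_on unit_disc \<and> h 0 = 1 \<and>
        (\<forall>z\<in>unit_disc. h z \<noteq> 0 \<and> f z = z * h z) \<and>
        (\<forall>z. norm z < ?R \<longrightarrow> norm (z * deriv h z / h z) < 2 / 3)"
  proof (rule product_log_deriv_witness[OF p q k two_step_factorization[OF f g p q k] R1])
    fix z :: complex
    assume z: "norm z < ?R"
    then have "(norm z)\<^sup>2 + 9 * norm z < 1"
      using root by (intro power2_add_mult_less[of _ ?R]) auto
    moreover have z1: "z \<in> unit_disc" "1 - (norm z)\<^sup>2 > 0"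
      using z R1 by (simp_all add: abs_square_less_1)
    ultimately have "6 * norm z / (1 - (norm z)\<^sup>2) < 2 / 3"
      by (simp add: field_simps)
    then have "4 * norm z / (1 - (norm z)\<^sup>2) + 2 * norm z / (1 - (norm z)\<^sup>2) < 2 / 3"
      by (simp flip: add_divide_distrib)
    then show "4 * norm z / (1 - (norm z)\<^sup>2)
        + norm (z * deriv (quot g (\<lambda>z. z * p z)) z / quot g (\<lambda>z. z * p z) z) < 2 / 3"
      using class_P_log_deriv_bound[OF k z1(1)] by linarith
  qed
qed

lemma admissible_radius_class_G2: "admissible_radius class_Sc class_G2 ((sqrt 265 - 15) / 10)"
  (is "admissible_radius _ _ ?R")
proof (rule admissible_radius_class_ScI)
  have s: "15 < sqrt 265" "sqrt 265 < 17"
    by (rule real_less_rsqrt, simp) (rule real_less_lsqrt; simp)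
  \<comment> \<open>\<open>4r / (1 - r\<^sup>2) + r / (1 - r) = (5r + r\<^sup>2) / (1 - r\<^sup>2)\<close>, which is \<open>2/3\<close> for \<open>5r\<^sup>2 + 15r = 2\<close>.\<close>
  have root: "?R\<^sup>2 + 3 * ?R = 2 / 5"
    by (simp add: power2_eq_square field_simps)
  show "0 < ?R" and R1: "?R < 1"
    using s by auto
  fix f
  assume "f \<in> class_G2"
  then obtain g p where f: "f \<in> class_A" and g: "g \<in> class_A" and p: "p \<in> class_P"
      and q: "quot f g \<in> class_P" and half: "quot g (\<lambda>z. z * p z) \<in> class_P_half"
    by (auto simp: class_G2_def)
  have k: "quot g (\<lambda>z. z * p z) \<in> class_P"
    using half by (simp add: class_P_half_def)
  show "\<exists>h. h holomorphic_on unit_disc \<and> h 0 = 1 \<and>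
        (\<forall>z\<in>unit_disc. h z \<noteq> 0 \<and> f z = z * h z) \<and>
        (\<forall>z. norm z < ?R \<longrightarrow> norm (z * deriv h z / h z) < 2 / 3)"
  proof (rule product_log_deriv_witness[OF p q k two_step_factorization[OF f g p q k] R1])
    fix z :: complex
    assume z: "norm z < ?R"
    then have less: "(norm z)\<^sup>2 + 3 * norm z < 2 / 5"
      using root by (intro power2_add_mult_less[of _ ?R]) auto
    have z1: "z \<in> unit_disc" "1 - (norm z)\<^sup>2 > 0" "1 - norm z > 0" "1 + norm z > 0"
      using z R1 by (simp_all add: abs_square_less_1 add_pos_nonneg)
    have "norm z / (1 - norm z) = (norm z + (norm z)\<^sup>2) / ((1 - norm z) * (1 + norm z))"
      using z1(3,4) by (simp add: divide_simps) (simp add: power2_eq_square algebra_simps)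
    also have "(1 - norm z) * (1 + norm z) = 1 - (norm z)\<^sup>2"
      by (simp add: power2_eq_square algebra_simps)
    finally have "4 * norm z / (1 - (norm z)\<^sup>2) + norm z / (1 - norm z)
        = (5 * norm z + (norm z)\<^sup>2) / (1 - (norm z)\<^sup>2)"
      by (simp flip: add_divide_distrib)
    also have "\<dots> < 2 / 3"
      using less z1(2) by (simp add: field_simps)
    finally show "4 * norm z / (1 - (norm z)\<^sup>2)
        + norm (z * deriv (quot g (\<lambda>z. z * p z)) z / quot g (\<lambda>z. z * p z) z) < 2 / 3"
      using class_P_half_log_deriv_bound[OF half z1(1)] by linarith
  qed
qed

lemma admissible_radius_class_G3: "admissible_radius class_Sc class_G3 (sqrt 10 - 3)"
  (is "admissible_radius _ _ ?R")
proof (rule admissible_radius_class_ScI)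
  have s: "3 < sqrt 10" "sqrt 10 < 4"
    by (rule real_less_rsqrt, simp) (rule real_less_lsqrt; simp)
  have root: "?R\<^sup>2 + 6 * ?R = 1"
    by (simp add: power2_eq_square algebra_simps)
  show "0 < ?R" and R1: "?R < 1"
    using s by auto
  fix f
  assume "f \<in> class_G3"
  then obtain p q where p: "p \<in> class_P" and q: "q \<in> class_P"
      and f: "\<And>z. z \<in> unit_disc \<Longrightarrow> f z = z * (p z * q z)"
    using class_G3_factorization by metis
  have one: "(\<lambda>_. 1) \<in> class_P"
    by (simp add: class_P_def)
  show "\<exists>h. h holomorphic_on unit_disc \<and> h 0 = 1 \<and>
        (\<forall>z\<in>unit_disc. h z \<noteq> 0 \<and> f z = z * h z) \<and>
        (\<forall>z. norm z < ?R \<longrightarrow> norm (z * deriv h z / h z) < 2 / 3)"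
  proof (rule product_log_deriv_witness[OF p q one _ R1])
    fix z :: complex
    assume z: "norm z < ?R"
    then have "(norm z)\<^sup>2 + 6 * norm z < 1"
      using root by (intro power2_add_mult_less[of _ ?R]) auto
    moreover have "1 - (norm z)\<^sup>2 > 0"
      using z R1 by (simp add: abs_square_less_1)
    ultimately show "4 * norm z / (1 - (norm z)\<^sup>2) + norm (z * deriv (\<lambda>_. 1) z / 1) < 2 / 3"
      by (simp add: field_simps)
  qed (use f in auto)
qed

text \<open>
  A number is admissible when all smaller \<open>r\<close> behave well, so admissibility passes to the
  supremum once that is known to be below \<open>1\<close>.
\<close>

lemma radius_exists:
  assumes adm: "admissible_radius \<G> \<F> R"
    and bdd: "\<And>R'. admissible_radius \<G> \<F> R' \<Longrightarrow> R' \<le> B" and B: "B < 1"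
  shows "\<exists>R'. is_radius \<G> \<F> R' \<and> R' \<ge> R"
proof -
  define A where "A = Collect (admissible_radius \<G> \<F>)"
  have R: "R \<in> A"
    using adm by (simp add: A_def)
  have bA: "bdd_above A"
    using bdd unfolding A_def by (intro bdd_aboveI[of _ B]) simp
  have upper: "R' \<le> Sup A" if "admissible_radius \<G> \<F> R'" for R'
    using that bA by (intro cSup_upper) (auto simp: A_def)
  have "admissible_radius \<G> \<F> (Sup A)"
    unfolding admissible_radius_def
  proof (intro conjI ballI allI impI)
    show "0 < Sup A"
      using upper[OF adm] adm by (auto simp: admissible_radius_def)
    have "Sup A \<le> B"
      using R bdd by (intro cSup_least) (auto simp: A_def)
    with B show "Sup A < 1"
      by simp
    fix f r
    assume f: "f \<in> \<F>" and r: "0 < r \<and> r < Sup A"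
    then obtain R' where "R' \<in> A" "r < R'"
      using less_cSup_iff[of A r] R bA by auto
    then show "(\<lambda>z. f (of_real r * z) / of_real r) \<in> \<G>"
      using f r by (auto simp: A_def admissible_radius_def)
  qed
  then show ?thesis
    using upper adm by (auto simp: is_radius_def)
qed

theorem theorem3p5:
  "is_radius class_Sc class_G1 ((sqrt 85 - 9) / 2) \<and>
   (\<exists>R. is_radius class_Sc class_G2 R \<and> R \<ge> (sqrt 265 - 15) / 10) \<and>
   is_radius class_Sc class_G3 (sqrt 10 - 3)"
proof (intro conjI)
  have "((sqrt 85 - 9) / 2)\<^sup>2 + 3 * real 3 * ((sqrt 85 - 9) / 2) = 1"
    by (simp add: power2_eq_square field_simps)
  then have "R' \<le> (sqrt 85 - 9) / 2" if "admissible_radius class_Sc class_G1 R'" for R'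
    using admissible_radius_extremal_le[OF that extremal_in_class_G1] admissible_radius_class_G1
    unfolding admissible_radius_def by blast
  then show "is_radius class_Sc class_G1 ((sqrt 85 - 9) / 2)"
    using admissible_radius_class_G1 by (simp add: is_radius_def)
  have root: "(sqrt 10 - 3)\<^sup>2 + 3 * real 2 * (sqrt 10 - 3) = 1"
    by (simp add: power2_eq_square algebra_simps)
  have R: "0 < sqrt 10 - 3" "sqrt 10 - 3 < 1"
    using admissible_radius_class_G3 by (auto simp: admissible_radius_def)
  show "is_radius class_Sc class_G3 (sqrt 10 - 3)"
    using admissible_radius_class_G3 admissible_radius_extremal_le[OF _ extremal_in_class_G3 R(1) root]
    by (auto simp: is_radius_def)
  show "\<exists>R. is_radius class_Sc class_G2 R \<and> R \<ge> (sqrt 265 - 15) / 10"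
    by (rule radius_exists[OF admissible_radius_class_G2
          admissible_radius_extremal_le[OF _ extremal_in_class_G2 R(1) root] R(2)])
qed

end
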